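(* Let $V$ be the additive group of points in $R^{n}$ for a subring $R \subset \mathbb{R}$, and let $H$ be a subgroup of $V_{0}$ that acts by translation on $V$. Fix $g \in R$. Suppose $\kappa \in V_{2g-2}$, and $\mathcal{N} \subset V_{g-1}$, satisfying the symmetry condition \[ \nu \in \mathcal{N} \Longleftrightarrow \kappa - \nu \in \mathcal{N}. \] Then for every $x \in V$, \[ \ell(x) - \ell(\kappa - x) = \deg(x) - g + 1 . \]
   Context: Here $n$ is a fixed positive integer, and $V = R^n$ is a group under component-wise addition. For $x \in V$, write $x(i)$ for the $i$-th component of $x$. The degree of $x$ is $\deg(x) = \sum_{i=1}^{n} x(i)$, and for $d \in R$ one sets $V_{d} = \{ x \in V \mid \deg(x) = d \}$; in particular $V_0$ is a subgroup of $V$. The subgroup $H \subset V_0$ acts on $V$ by $(h,x) \mapsto h + x$, inducing the equivalence relation $x \sim y$ if and only if $x - y \in H$. The parameter $g \in R$ is called the genus. For $x \in V$, $x^{+} = \max(x,0)$, with the maximum evaluated at each coordinate. Given the set $\mathcal{N} \subset V_{g-1}$, the dimension of $x \in V$ is defined to be \[ \ell(x) = \min_{\nu \in \mathcal{N}} \{ \deg((x-\nu)^{+}) \}. \] *)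

theory Defs
  imports "HOL-Analysis.Analysis" "HOL-Algebra.Algebraic_Closure_Type"
begin

definition points_over :: "real set \<Rightarrow> (real ^ 'n) set" where
  "points_over R = {x. \<forall>i. x $ i \<in> R}"

definition degree_vec :: "real ^ 'n \<Rightarrow> real" where
  "degree_vec x = (\<Sum>i\<in>UNIV. x $ i)"

definition degree_part :: "real set \<Rightarrow> real \<Rightarrow> (real ^ 'n) set" where
  "degree_part R d = {x \<in> points_over R. degree_vec x = d}"

text \<open>The additive group of all degree-zero points, in the (multiplicatively written) group
  record of the algebra library.\<close>

definition degree_zero_group :: "real set \<Rightarrow> (real ^ 'n) monoid" where
  "degree_zero_group R = \<lparr>carrier = degree_part R 0, monoid.mult = (+), one = 0\<rparr>"

definition pos_part_vec :: "real ^ 'n \<Rightarrow> real ^ 'n" where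
  "pos_part_vec x = (\<chi> i. max (x $ i) 0)"

text \<open>The minimum over a possibly infinite set \<open>N\<close> is rendered by the real infimum. The
  values are bounded below by 0, so for nonempty \<open>N\<close> this is a genuine infimum, and
  it is the minimum whenever the minimum is attained (lemma \<open>ell_eq_min\<close>). For
  \<open>R\<close> dense in the reals and arbitrary \<open>N\<close> it need not be attained.\<close>

definition ell :: "(real ^ 'n) set \<Rightarrow> real ^ 'n \<Rightarrow> real" where
  "ell N x = (INF \<nu>\<in>N. degree_vec (pos_part_vec (x - \<nu>)))"

lemma ell_eq_min:
  assumes "\<nu> \<in> N"
    and "\<And>\<mu>. \<mu> \<in> N \<Longrightarrow>
      degree_vec (pos_part_vec (x - \<nu>)) \<le> degree_vec (pos_part_vec (x - \<mu>))"
  shows "ell N x = degree_vec (pos_part_vec (x - \<nu>))"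
  unfolding ell_def by (rule cInf_eq_minimum) (use assms in auto)

lemma ell_eq_Min:
  assumes "finite N" and "N \<noteq> {}"
  shows "ell N x = Min ((\<lambda>\<nu>. degree_vec (pos_part_vec (x - \<nu>))) ` N)"
  unfolding ell_def by (rule cInf_eq_Min) (use assms in auto)

end

theory Submission
  imports Defs
begin

text \<open>Coordinatewise, \<open>t = max t 0 - max (-t) 0\<close>, so replacing \<open>x - \<nu>\<close> by its negative changes the
  degree of the positive part by exactly \<open>degree_vec (x - \<nu>)\<close>, which is
  \<open>degree_vec x - (g - 1)\<close> whatever \<open>\<nu> \<in> N\<close> is. Since
  \<open>\<nu> - x = (\<kappa> - x) - (\<kappa> - \<nu>)\<close> and \<open>\<nu> \<mapsto> \<kappa> - \<nu>\<close> is an involution of \<open>N\<close>, the family of values whose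
  infimum is \<open>ell N x\<close> is the family for \<open>ell N (\<kappa> - x)\<close> shifted by this constant, and so are
  the infima.

  Only one inequality between the infima has to be proved
  (lemma \<open>ell_le_dual\<close>): applied to \<open>\<kappa> - x\<close> in place of \<open>x\<close>, it becomes the reverse one.\<close>

lemma degree_vec_diff: "degree_vec (x - y) = degree_vec x - degree_vec y"
  by (simp add: degree_vec_def sum_subtractf)

lemma degree_vec_pos_part_nonneg: "0 \<le> degree_vec (pos_part_vec x)"
  by (simp add: degree_vec_def pos_part_vec_def sum_nonneg)

lemma degree_vec_pos_part_swap:
  "degree_vec (pos_part_vec (x - y)) = degree_vec x - degree_vec y + degree_vec (pos_part_vec (y - x))"
proof -
  have "max ((x - y) $ i) 0 = x $ i - y $ i + max ((y - x) $ i) 0" for i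
    by (simp add: max_def)
  then show ?thesis
    by (simp add: degree_vec_def pos_part_vec_def sum.distrib sum_subtractf)
qed

lemma ell_le:
  assumes "\<nu> \<in> N"
  shows "ell N x \<le> degree_vec (pos_part_vec (x - \<nu>))"
  unfolding ell_def
  by (intro cINF_lower[OF _ assms] bdd_belowI2[where m = 0] degree_vec_pos_part_nonneg)

text \<open>Each value \<open>degree_vec (pos_part_vec ((\<kappa> - x) - \<mu>))\<close> is matched with the value at \<open>x\<close> given by
  the reflected point \<open>\<kappa> - \<mu>\<close>; hence \<open>ell N x\<close>, shifted by a constant, is a lower bound of the
  whole family at \<open>\<kappa> - x\<close>.\<close>

lemma ell_le_dual:
  assumes nonempty: "N \<noteq> {}"
    and degree: "\<And>\<mu>. \<mu> \<in> N \<Longrightarrow> degree_vec \<mu> = d"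
    and reflect: "\<And>\<mu>. \<mu> \<in> N \<Longrightarrow> \<kappa> - \<mu> \<in> N"
  shows "ell N x \<le> degree_vec x - d + ell N (\<kappa> - x)"
proof -
  have "ell N x - (degree_vec x - d) \<le> degree_vec (pos_part_vec (\<kappa> - x - \<mu>))" if "\<mu> \<in> N" for \<mu>
  proof -
    have "ell N x \<le> degree_vec (pos_part_vec (x - (\<kappa> - \<mu>)))"
      by (intro ell_le reflect that)
    also have "\<dots> = degree_vec x - d + degree_vec (pos_part_vec (\<kappa> - \<mu> - x))"
      using degree_vec_pos_part_swap[of x "\<kappa> - \<mu>"] degree[OF reflect[OF that]] by simp
    also have "\<kappa> - \<mu> - x = \<kappa> - x - \<mu>"
      by simp
    finally show ?thesis
      by simp
  qed
  then have "ell N x - (degree_vec x - d) \<le> ell N (\<kappa> - x)"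
    unfolding ell_def[of N "\<kappa> - x"] by (intro cINF_greatest nonempty)
  then show ?thesis
    by simp
qed

theorem theorem1p1:
  fixes R :: "real set" and g :: real
    and H N :: "(real ^ 'n) set" and \<kappa> :: "real ^ 'n"
  assumes "subring R (ring_of_type_algebra :: real ring)"
    and "subgroup H (degree_zero_group R)"
    and "g \<in> R"
    and "\<kappa> \<in> degree_part R (2 * g - 2)"
    and "N \<subseteq> degree_part R (g - 1)"
    and "N \<noteq> {}"
    and "\<forall>\<nu>\<in>points_over R. \<nu> \<in> N \<longleftrightarrow> \<kappa> - \<nu> \<in> N"
  shows "\<forall>x\<in>points_over R. ell N x - ell N (\<kappa> - x) = degree_vec x - g + 1"
proof
  fix x :: "real ^ 'n"
  have degree_N: "degree_vec \<mu> = g - 1" and reflect: "\<kappa> - \<mu> \<in> N" if "\<mu> \<in> N" for \<mu>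
    using assms(5,7) that by (auto simp: degree_part_def)
  note dual = ell_le_dual[OF \<open>N \<noteq> {}\<close> degree_N reflect]
  have "degree_vec (\<kappa> - x) = 2 * g - 2 - degree_vec x"
    using assms(4) by (simp add: degree_part_def degree_vec_diff)
  then show "ell N x - ell N (\<kappa> - x) = degree_vec x - g + 1"
    using dual[of x] dual[of "\<kappa> - x"] by simp
qed

end
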